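(* Let $m\ge2$ and $N\ge1$ be integers, and let $Y_0,\dots,Y_{m-1}\in\mathbb S^{N\times N}_{++}$. Then the following hold: (i) The moving arithmetic mean sequence, defined by $Y_n=\frac1mY_{n-1}+\cdots+\frac1mY_{n-m}$ for all $n\ge m$, satisfies $$Y_n\to\frac{2}{m(m+1)}\sum_{j=0}^{m-1}(j+1)Y_j .$$ (ii) The moving harmonic mean sequence, defined by $Y_n=\big(\frac1mY_{n-1}^{-1}+\cdots+\frac1mY_{n-m}^{-1}\big)^{-1}$ for all $n\ge m$, satisfies $$Y_n\to\Big(\frac{2}{m(m+1)}\sum_{j=0}^{m-1}(j+1)Y_j^{-1}\Big)^{-1} .$$ (iii) The moving resolvent mean sequence, defined by $Y_n=\big(\frac1m(Y_{n-1}+\mathrm{Id})^{-1}+\cdots+\frac1m(Y_{n-m}+\mathrm{Id})^{-1}\big)^{-1}-\mathrm{Id}$ for all $n\ge m$, satisfies $$Y_n\to\Big(\frac{2}{m(m+1)}\sum_{j=0}^{m-1}(j+1)(Y_j+\mathrm{Id})^{-1}\Big)^{-1}-\mathrm{Id} .$$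
   Context: $\mathbb S^{N\times N}_{++}$ is the set of $N\times N$ real symmetric positive definite matrices, and $\mathrm{Id}$ is the $N\times N$ identity matrix. In each item the sequence starts from the given $Y_0,\dots,Y_{m-1}$. *)

theory Defs
  imports "HOL-Analysis.Analysis"
begin

definition spd_matrices :: "(real ^ 'n ^ 'n) set" where
  "spd_matrices = {A. transpose A = A \<and> (\<forall>x. x \<noteq> 0 \<longrightarrow> 0 < x \<bullet> (A *v x))}"

end

theory Submission
  imports Defs
begin
text \<open>
  All three statements come from one fact about the recursion
  \<open>Y (n + m) = (Y n + \<dots> + Y (n + m - 1)) / m\<close> in an arbitrary real normed space.

  The weighted sum \<open>Y n + 2 Y (n + 1) + \<dots> + m Y (n + m - 1)\<close> does not change with \<open>n\<close>: shifting
  the window removes one copy of each of its entries and adds \<open>m Y (n + m)\<close>, which is that very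
  sum of entries (\<open>weighted_window_sum_invariant\<close>). As the weights add up to \<open>m (m + 1) / 2\<close>, this
  identifies the only possible limit \<open>L\<close>. The differences \<open>Z n = Y n - L\<close> obey the same
  recursion, and now the weighted sum of each window vanishes. Subtracting a multiple of this zero
  from the average gives \<open>Z (n + m)\<close> as a combination of the window with nonnegative coefficients
  whose sum is less than \<open>1/2\<close> (\<open>moving_average_contraction\<close>). Hence the differences are at least
  halved every \<open>m\<close> steps and tend to zero (\<open>moving_average_tendsto\<close>).

  Inversion carries the harmonic mean recursion to the arithmetic one. Positive definite matrices
  are closed under inversion and under positive combinations, so all iterates and the limit of
  their inverses are invertible; since inversion is continuous there, the limit can be carried back
  (\<open>moving_harmonic_mean_tendsto\<close>). Finally, adding the identity turns the resolvent
  mean recursion into the harmonic one.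
\<close>

section \<open>Moving averages in a normed space\<close>

lemma sum_weights: "(\<Sum>j<k. real j + 1) = real k * (real k + 1) / 2"
  by (induction k) (simp_all add: field_simps)

text \<open>
  Since the weighted sum vanishes, it may be subtracted from the plain sum with any factor.
  The factor \<open>1 / m\<close> is the largest that keeps all the coefficients \<open>1 - (j + 1) / m\<close>
  nonnegative; the norm of the plain sum is then at most \<open>B\<close> times their sum \<open>(m - 1) / 2\<close>.
\<close>

lemma moving_average_contraction:
  fixes Z :: "nat \<Rightarrow> 'a::real_normed_vector"
  assumes m: "m > 0" and rec: "Z (n + m) = (1 / real m) *\<^sub>R (\<Sum>j<m. Z (n + j))"
    and zero: "(\<Sum>j<m. (real j + 1) *\<^sub>R Z (n + j)) = 0"
    and bound: "\<And>j. j < m \<Longrightarrow> norm (Z (n + j)) \<le> B" and B: "0 \<le> B"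
  shows "norm (Z (n + m)) \<le> B / 2"
proof -
  let ?w = "\<lambda>j. 1 - (real j + 1) / real m"
  have "(\<Sum>j<m. Z (n + j)) = (\<Sum>j<m. Z (n + j)) - (1 / real m) *\<^sub>R (\<Sum>j<m. (real j + 1) *\<^sub>R Z (n + j))"
    by (simp add: zero)
  also have "\<dots> = (\<Sum>j<m. ?w j *\<^sub>R Z (n + j))"
    by (simp add: scaleR_diff_left sum_subtractf scaleR_sum_right)
  finally have sum_eq: "(\<Sum>j<m. Z (n + j)) = (\<Sum>j<m. ?w j *\<^sub>R Z (n + j))" .
  have "norm (\<Sum>j<m. ?w j *\<^sub>R Z (n + j)) \<le> (\<Sum>j<m. ?w j * B)"
  proof (rule sum_norm_le)
    fix j assume "j \<in> {..<m}"
    moreover from this have "0 \<le> ?w j" by (simp add: divide_simps)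
    ultimately show "norm (?w j *\<^sub>R Z (n + j)) \<le> ?w j * B"
      using bound[of j] by (simp add: mult_left_mono)
  qed
  also have "\<dots> = (real m - 1) / 2 * B"
  proof -
    have "(\<Sum>j<m. ?w j) = real m - (\<Sum>j<m. real j + 1) / real m"
      by (simp only: sum_subtractf sum_divide_distrib) simp
    also have "\<dots> = (real m - 1) / 2"
      using m unfolding sum_weights by (simp add: field_simps)
    finally have "(\<Sum>j<m. ?w j) = (real m - 1) / 2" .
    then show ?thesis by (simp only: flip: sum_distrib_right)
  qed
  also have "\<dots> \<le> real m * (B / 2)" using B by (simp add: algebra_simps)
  finally have "norm (\<Sum>j<m. Z (n + j)) \<le> real m * (B / 2)" by (simp add: sum_eq)
  with m show ?thesis by (simp add: rec divide_simps mult.commute)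
qed

lemma weighted_window_sum_invariant:
  fixes Y :: "nat \<Rightarrow> 'a::real_vector"
  assumes m: "m > 0" and rec: "\<And>n. Y (n + m) = (1 / real m) *\<^sub>R (\<Sum>j<m. Y (n + j))"
  shows "(\<Sum>j<m. (real j + 1) *\<^sub>R Y (n + j)) = (\<Sum>j<m. (real j + 1) *\<^sub>R Y j)"
proof (induction n)
  case (Suc n)
  \<comment> \<open>The weight of every entry common to both windows drops by one; \<open>k\<close> is freed from \<open>m\<close> for the induction.\<close>
  have telescope: "(\<Sum>j<k. (real j + 1) *\<^sub>R Y (Suc n + j)) + (\<Sum>j<k. Y (n + j))
      = (\<Sum>j<k. (real j + 1) *\<^sub>R Y (n + j)) + real k *\<^sub>R Y (n + k)" for k
    by (induction k) (simp_all add: algebra_simps)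
  have "real m *\<^sub>R Y (n + m) = (\<Sum>j<m. Y (n + j))"
    using m by (simp add: rec)
  with telescope[of m] Suc show ?case by simp
qed simp

theorem moving_average_tendsto:
  fixes Y :: "nat \<Rightarrow> 'a::real_normed_vector"
  assumes m: "m > 0" and rec: "\<And>n. Y (n + m) = (1 / real m) *\<^sub>R (\<Sum>j<m. Y (n + j))"
  shows "Y \<longlonglongrightarrow> (2 / (real m * (real m + 1))) *\<^sub>R (\<Sum>j<m. (real j + 1) *\<^sub>R Y j)"
proof -
  define L where "L = (2 / (real m * (real m + 1))) *\<^sub>R (\<Sum>j<m. (real j + 1) *\<^sub>R Y j)"
  define Z where "Z n = Y n - L" for n
  have recZ: "Z (n + m) = (1 / real m) *\<^sub>R (\<Sum>j<m. Z (n + j))" for n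
    using m by (simp add: Z_def rec sum_subtractf scaleR_diff_right sum_constant_scaleR)
  have zero: "(\<Sum>j<m. (real j + 1) *\<^sub>R Z (n + j)) = 0" for n
  proof -
    have "(\<Sum>j<m. (real j + 1) *\<^sub>R Z (n + j))
        = (\<Sum>j<m. (real j + 1) *\<^sub>R Y (n + j)) - (\<Sum>j<m. real j + 1) *\<^sub>R L"
      by (simp add: Z_def scaleR_diff_right sum_subtractf scaleR_sum_left)
    also have "\<dots> = 0"
      using m by (simp add: weighted_window_sum_invariant[OF m rec] sum_weights L_def)
    finally show ?thesis .
  qed
  define B where "B = (\<Sum>j<m. norm (Z j))"
  have B: "B \<ge> 0" by (simp add: B_def sum_nonneg)
  have bound: "norm (Z k) \<le> B * (1/2) ^ (k div m)" for k
  proof (induction k rule: less_induct)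
    case (less k)
    show ?case
    proof (cases "k < m")
      case True
      then show ?thesis by (simp add: B_def member_le_sum[of k "{..<m}" "\<lambda>j. norm (Z j)"])
    next
      case False
      define n where "n = k - m"
      with False have k: "k = n + m" by simp
      have "norm (Z (n + m)) \<le> (B * (1/2) ^ (n div m)) / 2"
      proof (rule moving_average_contraction[OF m recZ zero])
        fix j assume "j < m"
        then have "norm (Z (n + j)) \<le> B * (1/2) ^ ((n + j) div m)"
          using less k by simp
        also have "\<dots> \<le> B * (1/2) ^ (n div m)"
          using B by (intro mult_left_mono power_decreasing div_le_mono) auto
        finally show "norm (Z (n + j)) \<le> B * (1/2) ^ (n div m)" .
      qed (use B in simp)
      then show ?thesis using m k by simp
    qed
  qed
  have "filterlim (\<lambda>k. k div m) at_top sequentially"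
    using m by (auto simp: filterlim_at_top eventually_sequentially
        intro!: exI[of _ "_ * m"] simp: less_eq_div_iff_mult_less_eq)
  then have "(\<lambda>k. (1/2 :: real) ^ (k div m)) \<longlonglongrightarrow> 0"
    by (rule filterlim_compose[OF LIMSEQ_power_zero, rotated]) simp
  then have "(\<lambda>k. B * (1/2) ^ (k div m)) \<longlonglongrightarrow> 0"
    by (rule tendsto_mult_right_zero)
  then have "Z \<longlonglongrightarrow> 0"
    by (rule Lim_null_comparison[rotated]) (simp add: bound)
  then show ?thesis
    unfolding Z_def L_def[symmetric] by (simp add: LIM_zero_iff)
qed

section \<open>Positive definite matrices and their inverses\<close>

definition positive_definite :: "real ^ 'n ^ 'n \<Rightarrow> bool" where
  "positive_definite A \<longleftrightarrow> (\<forall>x. x \<noteq> 0 \<longrightarrow> 0 < x \<bullet> (A *v x))"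

lemma positive_definite_invertible:
  assumes "positive_definite A" shows "invertible A"
  using assms unfolding positive_definite_def invertible_left_inverse matrix_left_invertible_ker
  by (metis inner_zero_right less_irrefl)

lemma matrix_inv_inverts:
  fixes A :: "'a::semiring_1 ^ 'n ^ 'm"
  assumes "invertible A"
  shows matrix_inv_right: "A ** matrix_inv A = mat 1"
    and matrix_inv_left: "matrix_inv A ** A = mat 1"
  using someI_ex[OF assms[unfolded invertible_def]] by (simp_all add: matrix_inv_def)

lemma matrix_inv_matrix_inv:
  fixes A :: "'a::semiring_1 ^ 'n ^ 'm"
  assumes A: "invertible A" shows "matrix_inv (matrix_inv A) = A"
proof -
  let ?B = "matrix_inv A"
  have "invertible ?B"
    unfolding invertible_def using matrix_inv_inverts[OF A] by blast
  then have "matrix_inv ?B = (A ** ?B) ** matrix_inv ?B"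
    by (simp add: matrix_inv_right[OF A])
  also have "\<dots> = A"
    by (simp add: matrix_inv_right[OF \<open>invertible ?B\<close>] flip: matrix_mul_assoc)
  finally show ?thesis .
qed

text \<open>Every \<open>x\<close> is \<open>A y\<close> for \<open>y\<close> the image of \<open>x\<close> under the inverse, so the form of the inverse at \<open>x\<close>
  is the form of \<open>A\<close> at \<open>y\<close>.\<close>

lemma positive_definite_matrix_inv:
  fixes A :: "real ^ 'n ^ 'n"
  assumes A: "positive_definite A" shows "positive_definite (matrix_inv A)"
  unfolding positive_definite_def
proof (intro allI impI)
  fix x :: "real ^ 'n" assume x: "x \<noteq> 0"
  let ?y = "matrix_inv A *v x"
  have Ay: "A *v ?y = x"
    by (simp add: matrix_vector_mul_assoc matrix_inv_right positive_definite_invertible[OF A])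
  with x have "?y \<noteq> 0" by auto
  with A have "0 < ?y \<bullet> (A *v ?y)" unfolding positive_definite_def by blast
  then show "0 < x \<bullet> ?y" by (simp add: Ay inner_commute)
qed

lemma positive_definite_add:
  "positive_definite A \<Longrightarrow> positive_definite B \<Longrightarrow> positive_definite (A + B)"
  by (simp add: positive_definite_def matrix_vector_mult_add_rdistrib inner_add_right add_pos_pos)

lemma positive_definite_scaleR:
  "c > 0 \<Longrightarrow> positive_definite A \<Longrightarrow> positive_definite (c *\<^sub>R A)"
  by (simp add: positive_definite_def flip: scaleR_matrix_vector_assoc)

lemma positive_definite_sum:
  assumes "finite I" "I \<noteq> {}" "\<And>i. i \<in> I \<Longrightarrow> positive_definite (A i)"
  shows "positive_definite (\<Sum>i\<in>I. A i)"
  using assms by (induction rule: finite_ne_induct) (auto intro: positive_definite_add)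

lemma positive_definite_mat_1: "positive_definite (mat 1)"
  by (simp add: positive_definite_def)

text \<open>Column \<open>j\<close> of the inverse solves \<open>A x = e\<^sub>j\<close>, so Cramer's rule expresses the entries of the inverse
  through determinants, which are polynomials in the entries of \<open>A\<close>. This is what
  makes inversion continuous.\<close>

lemma matrix_inv_cramer:
  fixes A :: "real ^ 'n ^ 'n"
  assumes "invertible A"
  shows "matrix_inv A $ i $ j
    = det (\<chi> r c. if c = i then axis j 1 $ r else A $ r $ c) / det A"
proof -
  have "A *v (matrix_inv A *v axis j 1) = axis j 1"
    using assms by (simp add: matrix_vector_mul_assoc matrix_inv_right)
  moreover have "det A \<noteq> 0" using assms invertible_det_nz by blast
  ultimately have "matrix_inv A *v axis j 1
      = (\<chi> k. det (\<chi> r c. if c = k then axis j 1 $ r else A $ r $ c) / det A)"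
    using cramer by blast
  then have "(matrix_inv A *v axis j 1) $ i
     = det (\<chi> r c. if c = i then axis j 1 $ r else A $ r $ c) / det A" by simp
  then show ?thesis by (simp add: matrix_vector_mult_basis column_def)
qed

lemma tendsto_det:
  fixes f :: "'b \<Rightarrow> real ^ 'n ^ 'n"
  assumes "\<And>i j. ((\<lambda>x. f x $ i $ j) \<longlongrightarrow> L $ i $ j) F"
  shows "((\<lambda>x. det (f x)) \<longlongrightarrow> det L) F"
  unfolding det_def by (intro tendsto_intros assms)

lemma tendsto_matrix_inv:
  fixes f :: "'b \<Rightarrow> real ^ 'n ^ 'n"
  assumes f: "(f \<longlongrightarrow> L) F" and L: "invertible L"
    and inv: "\<forall>\<^sub>F x in F. invertible (f x)"
  shows "((\<lambda>x. matrix_inv (f x)) \<longlongrightarrow> matrix_inv L) F"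
proof (intro vec_tendstoI)
  fix i j
  have entry: "((\<lambda>x. f x $ r $ c) \<longlongrightarrow> L $ r $ c) F" for r c
    by (intro tendsto_vec_nth f)
  let ?C = "\<lambda>A :: real ^ 'n ^ 'n. \<chi> r c. if c = i then axis j 1 $ r else A $ r $ c"
  have "((\<lambda>x. det (?C (f x))) \<longlongrightarrow> det (?C L)) F"
    by (rule tendsto_det) (auto intro: entry)
  moreover have "((\<lambda>x. det (f x)) \<longlongrightarrow> det L) F"
    by (rule tendsto_det) (rule entry)
  moreover have "det L \<noteq> 0" using L invertible_det_nz by blast
  ultimately have "((\<lambda>x. det (?C (f x)) / det (f x)) \<longlongrightarrow> matrix_inv L $ i $ j) F"
    unfolding matrix_inv_cramer[OF L] by (rule tendsto_divide)
  then show "((\<lambda>x. matrix_inv (f x) $ i $ j) \<longlongrightarrow> matrix_inv L $ i $ j) F"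
    by (rule Lim_transform_eventually)
       (use inv in \<open>eventually_elim, simp add: matrix_inv_cramer\<close>)
qed

section \<open>Moving harmonic means\<close>

lemma sum_window_reverse:
  fixes f :: "nat \<Rightarrow> 'a::comm_monoid_add"
  shows "(\<Sum>i=1..m. f (n + m - i)) = (\<Sum>j<m. f (n + j))"
  by (rule sum.reindex_bij_witness[of _ "\<lambda>j. m - j" "\<lambda>i. m - i"]) auto

text \<open>The inverses of the iterates form a moving average sequence. Definiteness has to be
  propagated along the recursion first, because \<open>matrix_inv\<close> is an involution only on invertible matrices.\<close>

theorem moving_harmonic_mean_tendsto:
  fixes Y :: "nat \<Rightarrow> real ^ 'n ^ 'n"
  assumes m: "m > 0" and init: "\<And>j. j < m \<Longrightarrow> positive_definite (Y j)"
    and rec: "\<And>n. Y (n + m) = matrix_inv ((1 / real m) *\<^sub>R (\<Sum>j<m. matrix_inv (Y (n + j))))"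
  shows "Y \<longlonglongrightarrow> matrix_inv
    ((2 / (real m * (real m + 1))) *\<^sub>R (\<Sum>j<m. (real j + 1) *\<^sub>R matrix_inv (Y j)))"
proof -
  have mean_pd: "positive_definite ((1 / real m) *\<^sub>R (\<Sum>j<m. matrix_inv (Y (n + j))))"
    if "\<And>j. j < m \<Longrightarrow> positive_definite (Y (n + j))" for n
    using m that by (intro positive_definite_scaleR positive_definite_sum
        positive_definite_matrix_inv) auto
  have pd: "positive_definite (Y k)" for k
  proof (induction k rule: less_induct)
    case (less k)
    show ?case
    proof (cases "k < m")
      case False
      define n where "n = k - m"
      with False have k: "k = n + m" by simp
      show ?thesis
        unfolding k rec by (intro positive_definite_matrix_inv mean_pd less) (simp add: k)
    qed (rule init)
  qed
  define W where "W n = matrix_inv (Y n)" for n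
  have Y: "Y n = matrix_inv (W n)" for n
    by (simp add: W_def matrix_inv_matrix_inv positive_definite_invertible pd)
  have "W (n + m) = (1 / real m) *\<^sub>R (\<Sum>j<m. W (n + j))" for n
    unfolding W_def rec[of n]
    by (intro matrix_inv_matrix_inv positive_definite_invertible mean_pd pd)
  then have "W \<longlonglongrightarrow> (2 / (real m * (real m + 1))) *\<^sub>R (\<Sum>j<m. (real j + 1) *\<^sub>R W j)"
    by (rule moving_average_tendsto[OF m])
  moreover have W_pd: "positive_definite (W n)" for n
    unfolding W_def by (intro positive_definite_matrix_inv pd)
  moreover have "positive_definite ((2 / (real m * (real m + 1))) *\<^sub>R (\<Sum>j<m. (real j + 1) *\<^sub>R W j))"
    using m by (intro positive_definite_scaleR positive_definite_sum W_pd) (auto intro: divide_pos_pos)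
  ultimately have "(\<lambda>n. matrix_inv (W n)) \<longlonglongrightarrow>
      matrix_inv ((2 / (real m * (real m + 1))) *\<^sub>R (\<Sum>j<m. (real j + 1) *\<^sub>R W j))"
    by (intro tendsto_matrix_inv always_eventually allI positive_definite_invertible)
  then show ?thesis unfolding Y[symmetric] by (simp only: W_def)
qed

theorem corollary5p3:
  fixes m :: nat
    and Y\<^sub>0 :: "nat \<Rightarrow> real ^ 'n ^ 'n"
  assumes "m \<ge> 2"
    and "\<And>j. j < m \<Longrightarrow> Y\<^sub>0 j \<in> spd_matrices"
  shows
    "(\<forall>Y :: nat \<Rightarrow> real ^ 'n ^ 'n.
        (\<forall>j<m. Y j = Y\<^sub>0 j) \<and>
        (\<forall>n\<ge>m. Y n = (\<Sum>i=1..m. (1 / real m) *\<^sub>R Y (n - i)))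
        \<longrightarrow> Y \<longlonglongrightarrow> (2 / (real m * (real m + 1))) *\<^sub>R (\<Sum>j=0..m-1. (real j + 1) *\<^sub>R Y\<^sub>0 j))
   \<and> (\<forall>Y :: nat \<Rightarrow> real ^ 'n ^ 'n.
        (\<forall>j<m. Y j = Y\<^sub>0 j) \<and>
        (\<forall>n\<ge>m. Y n = matrix_inv (\<Sum>i=1..m. (1 / real m) *\<^sub>R matrix_inv (Y (n - i))))
        \<longrightarrow> Y \<longlonglongrightarrow> matrix_inv
              ((2 / (real m * (real m + 1))) *\<^sub>R (\<Sum>j=0..m-1. (real j + 1) *\<^sub>R matrix_inv (Y\<^sub>0 j))))
   \<and> (\<forall>Y :: nat \<Rightarrow> real ^ 'n ^ 'n.
        (\<forall>j<m. Y j = Y\<^sub>0 j) \<and>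
        (\<forall>n\<ge>m. Y n = matrix_inv (\<Sum>i=1..m. (1 / real m) *\<^sub>R matrix_inv (Y (n - i) + mat 1)) - mat 1)
        \<longrightarrow> Y \<longlonglongrightarrow> matrix_inv
              ((2 / (real m * (real m + 1))) *\<^sub>R
                 (\<Sum>j=0..m-1. (real j + 1) *\<^sub>R matrix_inv (Y\<^sub>0 j + mat 1))) - mat 1)"
proof (intro conjI allI impI; elim conjE)
  have m: "m > 0" using assms(1) by simp
  have pd: "positive_definite (Y\<^sub>0 j)" if "j < m" for j
    using assms(2)[OF that] by (simp add: spd_matrices_def positive_definite_def)
  have window: "{0..m-1} = {..<m}" using m by auto
  fix Y :: "nat \<Rightarrow> real ^ 'n ^ 'n"
  assume init: "\<forall>j<m. Y j = Y\<^sub>0 j"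
  have limit_cong: "(\<Sum>j=0..m-1. (real j + 1) *\<^sub>R g (Y\<^sub>0 j)) = (\<Sum>j<m. (real j + 1) *\<^sub>R g (Y j))"
    for g :: "real ^ 'n ^ 'n \<Rightarrow> real ^ 'n ^ 'n"
    unfolding window using init by (intro sum.cong) auto
  have mean: "(\<Sum>i=1..m. (1 / real m) *\<^sub>R g (Y (n + m - i))) = (1 / real m) *\<^sub>R (\<Sum>j<m. g (Y (n + j)))"
    for g :: "real ^ 'n ^ 'n \<Rightarrow> real ^ 'n ^ 'n" and n
    unfolding scaleR_sum_right[symmetric] by (simp only: sum_window_reverse[of "\<lambda>k. g (Y k)"])
  {
    assume rec: "\<forall>n\<ge>m. Y n = (\<Sum>i=1..m. (1 / real m) *\<^sub>R Y (n - i))"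
    have "Y (n + m) = (1 / real m) *\<^sub>R (\<Sum>j<m. Y (n + j))" for n
      using rec[rule_format, of "n + m"] mean[of "\<lambda>A. A"] by simp
    then show "Y \<longlonglongrightarrow> (2 / (real m * (real m + 1))) *\<^sub>R (\<Sum>j=0..m-1. (real j + 1) *\<^sub>R Y\<^sub>0 j)"
      unfolding limit_cong[of "\<lambda>A. A"] by (rule moving_average_tendsto[OF m])
  next
    assume rec: "\<forall>n\<ge>m. Y n = matrix_inv (\<Sum>i=1..m. (1 / real m) *\<^sub>R matrix_inv (Y (n - i)))"
    have "Y (n + m) = matrix_inv ((1 / real m) *\<^sub>R (\<Sum>j<m. matrix_inv (Y (n + j))))" for n
      using rec[rule_format, of "n + m"] mean[of matrix_inv] by simp
    then show "Y \<longlonglongrightarrow> matrix_inv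
        ((2 / (real m * (real m + 1))) *\<^sub>R (\<Sum>j=0..m-1. (real j + 1) *\<^sub>R matrix_inv (Y\<^sub>0 j)))"
      unfolding limit_cong[of matrix_inv]
      by (intro moving_harmonic_mean_tendsto[OF m]) (use init pd in auto)
  next
    assume rec: "\<forall>n\<ge>m. Y n =
      matrix_inv (\<Sum>i=1..m. (1 / real m) *\<^sub>R matrix_inv (Y (n - i) + mat 1)) - mat 1"
    have "Y (n + m) + mat 1 = matrix_inv ((1 / real m) *\<^sub>R (\<Sum>j<m. matrix_inv (Y (n + j) + mat 1)))" for n
      using rec[rule_format, of "n + m"] mean[of "\<lambda>A. matrix_inv (A + mat 1)"] by simp
    then have "(\<lambda>n. Y n + mat 1) \<longlonglongrightarrow> matrix_inv ((2 / (real m * (real m + 1))) *\<^sub>R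
        (\<Sum>j<m. (real j + 1) *\<^sub>R matrix_inv (Y j + mat 1)))"
      by (intro moving_harmonic_mean_tendsto[OF m])
         (use init pd in \<open>auto intro: positive_definite_add positive_definite_mat_1\<close>)
    then have "(\<lambda>n. Y n + mat 1 - mat 1) \<longlonglongrightarrow> matrix_inv ((2 / (real m * (real m + 1))) *\<^sub>R
        (\<Sum>j<m. (real j + 1) *\<^sub>R matrix_inv (Y j + mat 1))) - mat 1"
      by (intro tendsto_diff tendsto_const)
    then show "Y \<longlonglongrightarrow> matrix_inv ((2 / (real m * (real m + 1))) *\<^sub>R
        (\<Sum>j=0..m-1. (real j + 1) *\<^sub>R matrix_inv (Y\<^sub>0 j + mat 1))) - mat 1"
      unfolding limit_cong[of "\<lambda>A. matrix_inv (A + mat 1)"] by simp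
  }
qed
end
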